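(* Let $\delta=\delta(n)$ be a function with $\sqrt{n}\ll\delta(n)\le n-1$, and let $\mathcal{G}_\delta=(G_1,G_2,\ldots,G_n,\ldots)$ be any sequence of graphs with each $G_n\in\mathbf{G}(n,\delta)$. Then every pebbling threshold for $\mathcal{G}_\delta$ belongs to $O(n^{3/2}/\delta)$, i.e. $\tau(\mathcal{G}_\delta)\subseteq O(n^{3/2}/\delta)$. In particular, if in addition $\delta\in\Omega(n)$, then $\tau(\mathcal{G}_\delta)=\Theta(n^{1/2})$.
   Context: Let $G=(V,E)$ be a connected graph. A configuration of $t$ pebbles on $G$ is a function $C:V\to\mathbb{Z}_{\ge 0}$ with $\sum_{v}C(v)=t$ (pebbles are indistinguishable). A pebbling step from a vertex $u$ to an adjacent vertex $v$ removes two pebbles from $u$ and adds one pebble to $v$. A configuration is $r$-solvable if a pebble can be placed on the root $r$ via a (possibly empty) sequence of pebbling steps, and solvable if it is $r$-solvable for every vertex $r$. For functions $f=f(n),g=g(n)$: $f\ll g$ means $f/g\to 0$ as $n\to\infty$; $O(f)$ is the set of $g$ with $g<cf$ for all $n>k$ for some constants $c,k>0$; $\Omega(g)$ is the set of $f$ with $f>cg$ for all $n>k$ for some $c,k>0$; $\Theta(f)=O(f)\cap\Omega(f)$. $\mathbf{G}(n,\delta)$ denotes the set of all connected graphs on $n$ vertices with minimum degree at least $\delta=\delta(n)$. For a sequence of graphs $\mathcal{G}=(G_1,\ldots,G_n,\ldots)$ with $G_n$ having $n$ vertices and a function $t=t(n)$, $\Pr_t(n)$ is the probability that a configuration of $t$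 pebbles on $G_n$, chosen uniformly at random among all configurations of $t$ pebbles on $G_n$, is solvable. A function $\tau=\tau(n)$ is a pebbling threshold for $\mathcal{G}$ if $\Pr_t(n)\to 1$ for all $t\gg\tau$ and $\Pr_t(n)\to 0$ for all $t\ll\tau$; $\tau(\mathcal{G})$ denotes the set of all pebbling thresholds for $\mathcal{G}$. *)

theory Defs
  imports
    "HOL-Probability.Probability_Mass_Function"
    "HOL-Library.Landau_Symbols"
    "Graph_Theory.Graph_Theory"
begin

text \<open>
  A finite simple graph is a \<^locale>\<open>pair_graph\<close>: a finite digraph without loops or parallel
  arcs whose arc set is symmetric, so that each undirected edge is a pair of opposite arcs and the
  degree of a vertex is its out-degree.
\<close>

definition connected_graphs_min_degree :: "nat \<Rightarrow> real \<Rightarrow> 'a pair_pre_digraph set" where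
  "connected_graphs_min_degree n d =
     {G. pair_graph G \<and> Digraph_Component.connected (with_proj G) \<and> card (pverts G) = n \<and>
         (\<forall>v\<in>pverts G. d \<le> real (out_degree (with_proj G) v))}"

text \<open>
  A configuration is a function on the vertex set only. It is represented by its extension by zero,
  so that distinct HOL functions are distinct configurations and counting is correct.
\<close>

definition configurations :: "'a pair_pre_digraph \<Rightarrow> nat \<Rightarrow> ('a \<Rightarrow> nat) set" where
  "configurations G t = {C. (\<forall>v. v \<notin> pverts G \<longrightarrow> C v = 0) \<and> (\<Sum>v\<in>pverts G. C v) = t}"

inductive pebbling_step :: "'a pair_pre_digraph \<Rightarrow> ('a \<Rightarrow> nat) \<Rightarrow> ('a \<Rightarrow> nat) \<Rightarrow> bool"
  for G where
  "(u, v) \<in> parcs G \<Longrightarrow> 2 \<le> C u \<Longrightarrow> pebbling_step G C (C(u := C u - 2, v := C v + 1))"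

definition root_solvable :: "'a pair_pre_digraph \<Rightarrow> 'a \<Rightarrow> ('a \<Rightarrow> nat) \<Rightarrow> bool" where
  "root_solvable G r C \<longleftrightarrow> (\<exists>C'. (pebbling_step G)\<^sup>*\<^sup>* C C' \<and> 1 \<le> C' r)"

definition solvable :: "'a pair_pre_digraph \<Rightarrow> ('a \<Rightarrow> nat) \<Rightarrow> bool" where
  "solvable G C \<longleftrightarrow> (\<forall>r\<in>pverts G. root_solvable G r C)"

definition solvable_prob :: "'a pair_pre_digraph \<Rightarrow> nat \<Rightarrow> real" where
  "solvable_prob G t = measure_pmf.prob (pmf_of_set (configurations G t)) {C. solvable G C}"

text \<open>The uniform distribution in \<^const>\<open>solvable_prob\<close> is meaningful on every nonempty finite graph:\<close>

lemma finite_configurations: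
  assumes "finite (pverts G)"
  shows "finite (configurations G t)"
proof (rule finite_subset)
  show "configurations G t \<subseteq> {C. \<forall>v. (v \<in> pverts G \<longrightarrow> C v \<in> {..t}) \<and> (v \<notin> pverts G \<longrightarrow> C v = 0)}"
    using assms by (auto simp: configurations_def intro: member_le_sum)
  show "finite {C. \<forall>v. (v \<in> pverts G \<longrightarrow> C v \<in> {..t}) \<and> (v \<notin> pverts G \<longrightarrow> C v = 0)}"
    using assms by (intro finite_set_of_finite_funs) auto
qed

lemma configurations_nonempty:
  assumes "finite (pverts G)" "pverts G \<noteq> {}"
  shows "configurations G t \<noteq> {}"
proof -
  obtain r where "r \<in> pverts G" using assms(2) by blast
  then have "(\<lambda>v. if v = r then t else 0) \<in> configurations G t"
    using assms(1) by (auto simp: configurations_def)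
  then show ?thesis by blast
qed

text \<open>
  The relation "f is much smaller than g" is Landau's little-o, which for eventually positive g
  is convergence of f/g to 0 and, unlike the quotient, is not affected by division by zero.
  Landau symbols in the library compare absolute values, whereas thresholds are numbers of pebbles;
  hence the explicit nonnegativity condition.
\<close>

definition pebbling_thresholds :: "(nat \<Rightarrow> 'a pair_pre_digraph) \<Rightarrow> (nat \<Rightarrow> real) set" where
  "pebbling_thresholds \<G> =
     {\<tau>. (\<forall>\<^sub>F n in sequentially. 0 \<le> \<tau> n) \<and>
         (\<forall>t :: nat \<Rightarrow> nat. \<tau> \<in> o(\<lambda>n. real (t n)) \<longrightarrow> (\<lambda>n. solvable_prob (\<G> n) (t n)) \<longlonglongrightarrow> 1) \<and>
         (\<forall>t :: nat \<Rightarrow> nat. (\<lambda>n. real (t n)) \<in> o(\<tau>) \<longrightarrow> (\<lambda>n. solvable_prob (\<G> n) (t n)) \<longlonglongrightarrow> 0)}"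

end

theory Submission
  imports Defs
begin

text \<open>
  For \<open>t \<le> n\<close> pebbles on \<open>n\<close> vertices, the events that a vertex carries at least two pebbles have
  probability about \<open>(t / n)\<^sup>2\<close> and are pairwise nonpositively correlated, so Chebyshev's inequality
  shows that a fixed set of \<open>\<delta>\<close> vertices contains fewer than four such vertices with probability
  \<open>O(n\<^sup>2 / (\<delta> t\<^sup>2))\<close>. A maximal family of disjoint neighbourhoods has at most \<open>n / \<delta>\<close> members, and every
  vertex is within distance two of the centre of one of them; four pebbles gathered at the centre
  suffice to reach it. The union bound \<open>O(n\<^sup>3 / (\<delta> t)\<^sup>2)\<close> is small for \<open>t\<close> a large multiple of
  \<open>n\<^bsup>3/2\<^esup> / \<delta>\<close>. Conversely, if \<open>t\<close> is a small multiple of \<open>\<surd>n\<close>, then with high probability no vertex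
  carries two pebbles and no pebbling step is possible.
\<close>

section \<open>Counting configurations with lower bounds on some vertices\<close>

text \<open>Stars and bars: \<open>count\<close> identifies the multisets of size \<open>t\<close>
  over the vertex set with the configurations.\<close>

lemma card_configurations:
  assumes "finite (pverts G)"
  shows "card (configurations G t) = (card (pverts G) + t - 1) choose t"
proof -
  have size_eq: "size X = (\<Sum>v\<in>pverts G. count X v)" if "set_mset X \<subseteq> pverts G" for X
    unfolding size_multiset_overloaded_eq using that assms
    by (intro sum.mono_neutral_left) (auto simp flip: count_eq_zero_iff)
  have "bij_betw count (multisets_of_size (pverts G) t) (configurations G t)"
  proof (rule bij_betw_imageI)
    show "inj_on count (multisets_of_size (pverts G) t)"
      by (auto intro!: inj_onI multiset_eqI)
    show "count ` multisets_of_size (pverts G) t = configurations G t"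
    proof (intro equalityI subsetI)
      fix C assume "C \<in> count ` multisets_of_size (pverts G) t"
      then show "C \<in> configurations G t"
        using size_eq by (auto simp: multisets_of_size_def configurations_def count_eq_zero_iff)
    next
      fix C assume C: "C \<in> configurations G t"
      have "{v. C v > 0} \<subseteq> pverts G"
        using C by (auto simp: configurations_def intro: ccontr)
      then have "finite {v. C v > 0}"
        using assms by (rule finite_subset)
      then have cnt: "count (Abs_multiset C) = C"
        by (simp add: Abs_multiset_inverse)
      have "set_mset (Abs_multiset C) \<subseteq> pverts G"
        using C by (auto simp: configurations_def set_mset_def cnt intro: ccontr)
      then have "Abs_multiset C \<in> multisets_of_size (pverts G) t"
        using C size_eq[of "Abs_multiset C"]
        by (simp add: multisets_of_size_def configurations_def cnt)
      then show "C \<in> count ` multisets_of_size (pverts G) t"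
        using cnt by (metis imageI)
    qed
  qed
  then show ?thesis
    using card_multisets_of_size[OF assms] bij_betw_same_card by metis
qed

text \<open>The ratio of consecutive binomial coefficients, multiplied out to stay in the naturals.
  Used twice, it compares the counts for \<open>t\<close> and \<open>t + 2\<close>.\<close>

lemma card_configurations_Suc:
  assumes "finite (pverts G)" "pverts G \<noteq> {}"
  shows "Suc t * card (configurations G (Suc t)) = (card (pverts G) + t) * card (configurations G t)"
proof -
  obtain m where m: "card (pverts G) = Suc m"
    using assms by (metis card_0_eq not0_implies_Suc)
  show ?thesis
    using binomial_absorb_comp[of "m + Suc t" "t"] Suc_times_binomial_add[of t m]
    by (simp add: card_configurations assms m binomial_absorption add.commute)
qed

text \<open>Taking the obligatory pebbles \<open>D\<close> away is a bijection, with adding them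
  back as inverse.\<close>

lemma card_configurations_ge:
  assumes "finite (pverts G)" "\<And>v. v \<notin> pverts G \<Longrightarrow> D v = 0" "(\<Sum>v\<in>pverts G. D v) = s"
  shows "card {C \<in> configurations G (t + s). \<forall>v. D v \<le> C v} = card (configurations G t)"
proof (rule bij_betw_same_card)
  show "bij_betw (\<lambda>C v. C v - D v) {C \<in> configurations G (t + s). \<forall>v. D v \<le> C v} (configurations G t)"
    by (rule bij_betw_byWitness[where f' = "\<lambda>C v. C v + D v"])
      (use assms in \<open>auto simp: configurations_def sum.distrib sum_subtractf_nat\<close>)
qed

lemma card_configurations_ge_2:
  assumes "finite (pverts G)" "A \<subseteq> pverts G"
  shows "card {C \<in> configurations G (t + 2 * card A). \<forall>v\<in>A. 2 \<le> C v} = card (configurations G t)"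
proof -
  have eq: "{C \<in> configurations G (t + 2 * card A). \<forall>v\<in>A. 2 \<le> C v} =
     {C \<in> configurations G (t + 2 * card A). \<forall>v. (if v \<in> A then 2 else 0) \<le> C v}"
    by auto
  have "(\<Sum>v\<in>pverts G. if v \<in> A then 2 else 0) = 2 * card A"
    using assms by (simp add: sum.If_cases Int_absorb1 flip: sum.inter_restrict)
  then show ?thesis
    unfolding eq using assms by (intro card_configurations_ge) auto
qed

lemma card_configurations_doubled:
  assumes "finite (pverts G)" "v \<in> pverts G"
  shows "card {C \<in> configurations G (t + 2). 2 \<le> C v} = card (configurations G t)"
  using card_configurations_ge_2[of G "{v}" t] assms by (simp del: add_2_eq_Suc')

lemma card_configurations_doubled_pair:
  assumes "finite (pverts G)" "u \<in> pverts G" "v \<in> pverts G" "u \<noteq> v"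
  shows "card {C \<in> configurations G (t + 4). 2 \<le> C u \<and> 2 \<le> C v} = card (configurations G t)"
  using card_configurations_ge_2[of G "{u, v}" t] assms by simp

lemma no_configuration_of_few_pebbles:
  assumes "finite (pverts G)" "A \<subseteq> pverts G" "t < 2 * card A"
  shows "{C \<in> configurations G t. \<forall>v\<in>A. 2 \<le> C v} = {}"
proof -
  have False if "C \<in> configurations G t" "\<forall>v\<in>A. 2 \<le> C v" for C
  proof -
    have "2 * card A \<le> (\<Sum>v\<in>A. C v)"
      using sum_mono[of A "\<lambda>_. 2" C] that by simp
    also have "\<dots> \<le> (\<Sum>v\<in>pverts G. C v)"
      using assms by (intro sum_mono2) auto
    finally show False
      using that assms by (simp add: configurations_def)
  qed
  then show ?thesis by blast
qed

section \<open>Doubled vertices: probability and pair correlation\<close>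

text \<open>The probability that a given one of \<open>n\<close> vertices carries at least two of \<open>t\<close> pebbles.\<close>

definition doubled_prob :: "nat \<Rightarrow> nat \<Rightarrow> real" where
  "doubled_prob n t = real t * (real t - 1) / ((real n + real t - 1) * (real n + real t - 2))"

text \<open>Configurations doubled at \<open>v\<close> correspond to configurations of
  \<open>t - 2\<close> pebbles, so the probability is the ratio of two counts that lie two steps of
  \<open>card_configurations_Suc\<close> apart.\<close>

lemma card_doubled:
  assumes "finite (pverts G)" "v \<in> pverts G" "2 \<le> card (pverts G)"
  shows "real (card {C \<in> configurations G t. 2 \<le> C v}) =
    doubled_prob (card (pverts G)) t * real (card (configurations G t))"
proof (cases "t < 2")
  \<comment> \<open>Below two pebbles the factor t(t - 1) vanishes, in agreement with the empty
    event.\<close>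
  case True
  then have "t = 0 \<or> t = 1" by auto
  then show ?thesis
    using no_configuration_of_few_pebbles[OF assms(1), of "{v}" t] assms True
    by (auto simp: doubled_prob_def simp del: Collect_empty_eq)
next
  case False
  then obtain s where s: "t = s + 2" by (metis add.commute le_Suc_ex not_less)
  define n where "n = card (pverts G)"
  define c where "c = (\<lambda>t. real (card (configurations G t)))"
  have ne: "pverts G \<noteq> {}" using assms by auto
  have rec: "real (Suc t) * c (Suc t) = (real n + real t) * c t" for t
    using card_configurations_Suc[OF assms(1) ne, of t]
    unfolding c_def n_def by (metis of_nat_add of_nat_mult)
  have r1: "(real s + 1) * c (Suc s) = (real n + real s) * c s"
    and r2: "(real s + 2) * c (s + 2) = (real n + real s + 1) * c (Suc s)"
    using rec[of s] rec[of "Suc s"] by (simp_all add: algebra_simps)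
  have "(real s + 2) * (real s + 1) * c (s + 2) = (real s + 1) * ((real s + 2) * c (s + 2))"
    by (simp only: mult_ac)
  also have "\<dots> = (real n + real s + 1) * ((real s + 1) * c (Suc s))"
    by (simp only: r2 mult_ac)
  also have "\<dots> = (real n + real s + 1) * ((real n + real s) * c s)"
    by (simp only: r1)
  finally have "(real s + 2) * (real s + 1) * c (s + 2) = (real n + real s + 1) * ((real n + real s) * c s)" .
  moreover have "real n + real s + 1 \<noteq> 0" "real n + real s \<noteq> 0"
    using assms(3) by (auto simp: n_def)
  ultimately have "c s = (real s + 2) * (real s + 1) / ((real n + real s + 1) * (real n + real s)) * c (s + 2)"
    by (simp only: times_divide_eq_left) (simp add: mult.assoc)
  also have "(real s + 2) * (real s + 1) / ((real n + real s + 1) * (real n + real s)) = doubled_prob n t"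
    by (simp add: doubled_prob_def s algebra_simps)
  finally show ?thesis
    unfolding s card_configurations_doubled[OF assms(1,2)] by (simp only: c_def n_def)
qed

lemma doubled_prob_nonneg:
  assumes "2 \<le> n"
  shows "0 \<le> doubled_prob n t"
  using assms unfolding doubled_prob_def
  by (cases t) (auto intro!: divide_nonneg_nonneg mult_nonneg_nonneg)

text \<open>\<open>doubled_prob n t\<close> is the product of x / (n + x - 1) at x = t and x = t -
  1, and each factor grows when x grows by 2. The nonpositive correlation of doubled vertices rests
  on this.\<close>

lemma doubled_prob_mono_shift:
  assumes "2 \<le> n" "2 \<le> t"
  shows "doubled_prob n (t - 2) \<le> doubled_prob n t"
proof -
  obtain s where s: "t = s + 2" using assms by (metis add.commute le_Suc_ex)
  have n: "real n \<ge> 2" using assms by simp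
  have mono: "x / (real n + x - 1) \<le> (x + 2) / (real n + (x + 2) - 1)" if "x \<ge> 0" for x
    using n that by (simp add: divide_simps) (simp add: algebra_simps)
  show ?thesis
  \<comment> \<open>At s = 0 the second factor has x = -1, outside the range of \<open>mono\<close>;
    there the left side is 0.\<close>
  proof (cases "s = 0")
    case True
    then show ?thesis using doubled_prob_nonneg[OF assms(1), of t] s by (simp add: doubled_prob_def)
  next
    case False
    then have s1: "real s \<ge> 1" by simp
    have "real s / (real n + real s - 1) * ((real s - 1) / (real n + (real s - 1) - 1)) \<le>
      (real s + 2) / (real n + (real s + 2) - 1) * ((real s - 1 + 2) / (real n + (real s - 1 + 2) - 1))"
      using n s1 by (intro mult_mono mono) auto
    then show ?thesis
      by (simp add: doubled_prob_def s algebra_simps)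
  qed
qed

text \<open>Removing two pebbles from each vertex gives the exact probability
  \<open>doubled_prob n (t - 2) * doubled_prob n t\<close>: once one vertex is doubled, two fewer
  pebbles are left for the other. Monotonicity turns this into a square.\<close>

lemma card_doubled_pair_le:
  assumes "finite (pverts G)" "u \<in> pverts G" "v \<in> pverts G" "u \<noteq> v"
  shows "real (card {C \<in> configurations G t. 2 \<le> C u \<and> 2 \<le> C v}) \<le>
    (doubled_prob (card (pverts G)) t)\<^sup>2 * real (card (configurations G t))"
proof (cases "t < 4")
  case True
  have "{C \<in> configurations G t. 2 \<le> C u \<and> 2 \<le> C v} = {}"
    using no_configuration_of_few_pebbles[OF assms(1), of "{u, v}" t] assms True by simp
  then have "real (card {C \<in> configurations G t. 2 \<le> C u \<and> 2 \<le> C v}) = 0" by (simp only: card.empty of_nat_0)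
  then show ?thesis by simp
next
  case False
  then obtain s where s: "t = s + 4" by (metis add.commute le_Suc_ex not_less)
  define n where "n = card (pverts G)"
  define p where "p = doubled_prob n"
  have n: "2 \<le> n"
    using card_mono[of "pverts G" "{u, v}"] assms by (simp add: n_def)
  define c where "c = (\<lambda>t. real (card (configurations G t)))"
  have single: "c t = p (t + 2) * c (t + 2)" for t
    using card_doubled[OF assms(1,3), of "t + 2"] n
    unfolding card_configurations_doubled[OF assms(1,3)] by (simp only: c_def p_def n_def)
  have "real (card {C \<in> configurations G t. 2 \<le> C u \<and> 2 \<le> C v}) = c s"
    unfolding s card_configurations_doubled_pair[OF assms] c_def ..
  also have "\<dots> = p (t - 2) * (p t * c t)"
  proof -
    have "t - 2 = s + 2" "t = s + 2 + 2" using s by simp_all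
    then show ?thesis using single[of s] single[of "s + 2"] by (simp only:)
  qed
  also have "\<dots> \<le> p t * (p t * c t)"
    using doubled_prob_mono_shift[OF n, of t] doubled_prob_nonneg[OF n, of t] s
    by (intro mult_right_mono) (auto simp: p_def c_def)
  finally show ?thesis
    by (simp add: p_def n_def c_def power2_eq_square mult.assoc)
qed

section \<open>The second moment method\<close>

text \<open>Chebyshev's inequality in counting form; pairwise nonpositive correlation suffices.\<close>

lemma second_moment_count:
  fixes E :: "'v \<Rightarrow> 'w \<Rightarrow> bool" and p :: real
  assumes "finite \<Omega>" "finite S" "0 \<le> p" "1 \<le> k"
    and single: "\<And>v. v \<in> S \<Longrightarrow> real (card {\<omega> \<in> \<Omega>. E v \<omega>}) = p * real (card \<Omega>)"
    and pair: "\<And>u v. u \<in> S \<Longrightarrow> v \<in> S \<Longrightarrow> u \<noteq> v \<Longrightarrow>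
      real (card {\<omega> \<in> \<Omega>. E u \<omega> \<and> E v \<omega>}) \<le> p\<^sup>2 * real (card \<Omega>)"
  shows "real (card {\<omega> \<in> \<Omega>. card {v \<in> S. E v \<omega>} < k}) * (p * real (card S)) \<le> 4 * real k * real (card \<Omega>)"
proof -
  define \<mu> where "\<mu> = p * real (card S)"
  define X where "X = (\<lambda>\<omega>. real (card {v \<in> S. E v \<omega>}))"
  define B where "B = {\<omega> \<in> \<Omega>. card {v \<in> S. E v \<omega>} < k}"
  define c where "c = real (card \<Omega>)"
  have B: "B \<subseteq> \<Omega>" "finite B" using assms(1) by (auto simp: B_def)
  have cB: "real (card B) \<le> c" using card_mono[OF assms(1) B(1)] by (simp add: c_def)
  have mu0: "\<mu> \<ge> 0" using assms(3) by (simp add: \<mu>_def)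
  have Xsum: "X \<omega> = (\<Sum>v\<in>S. of_bool (E v \<omega>))" for \<omega>
    using assms(2) by (simp add: X_def of_bool_def sum.If_cases Collect_conj_eq)
  have cnt: "(\<Sum>\<omega>\<in>\<Omega>. of_bool (P \<omega>)) = real (card {\<omega> \<in> \<Omega>. P \<omega>})" for P
    using assms(1) by (simp add: of_bool_def sum.If_cases Collect_conj_eq)
  have m1: "(\<Sum>\<omega>\<in>\<Omega>. X \<omega>) = \<mu> * c"
  proof -
    have "(\<Sum>\<omega>\<in>\<Omega>. X \<omega>) = (\<Sum>v\<in>S. \<Sum>\<omega>\<in>\<Omega>. of_bool (E v \<omega>))"
      unfolding Xsum by (rule sum.swap)
    also have "\<dots> = (\<Sum>v\<in>S. p * c)"
      by (intro sum.cong) (simp_all add: cnt single c_def)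
    finally show ?thesis by (simp add: \<mu>_def)
  qed
  have m2: "(\<Sum>\<omega>\<in>\<Omega>. (X \<omega>)\<^sup>2) \<le> \<mu> * c + \<mu>\<^sup>2 * c"
  proof -
    have "(\<Sum>\<omega>\<in>\<Omega>. (X \<omega>)\<^sup>2) = (\<Sum>\<omega>\<in>\<Omega>. \<Sum>u\<in>S. \<Sum>v\<in>S. of_bool (E u \<omega> \<and> E v \<omega>))"
      unfolding Xsum power2_eq_square sum_product by (simp add: of_bool_conj)
    also have "\<dots> = (\<Sum>u\<in>S. \<Sum>\<omega>\<in>\<Omega>. \<Sum>v\<in>S. of_bool (E u \<omega> \<and> E v \<omega>))"
      by (rule sum.swap)
    also have "\<dots> = (\<Sum>u\<in>S. \<Sum>v\<in>S. \<Sum>\<omega>\<in>\<Omega>. of_bool (E u \<omega> \<and> E v \<omega>))"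
      by (intro sum.cong refl sum.swap)
    \<comment> \<open>On the diagonal the two events coincide and contribute p c. Charging p^2 c
      there as well only weakens the bound and makes the double sum exactly \<mu>^2 c plus \<mu>
      c.\<close>
    also have "\<dots> \<le> (\<Sum>u\<in>S. \<Sum>v\<in>S. p\<^sup>2 * c + of_bool (u = v) * (p * c))"
    proof (intro sum_mono)
      fix u v assume uv: "u \<in> S" "v \<in> S"
      show "(\<Sum>\<omega>\<in>\<Omega>. of_bool (E u \<omega> \<and> E v \<omega>)) \<le> p\<^sup>2 * c + of_bool (u = v) * (p * c)"
        using pair[OF uv] single[OF uv(1)] unfolding cnt c_def by (cases "u = v") auto
    qed
    also have "\<dots> = (\<Sum>u\<in>S. real (card S) * (p\<^sup>2 * c) + p * c)"
      using assms(2) by (intro sum.cong refl) (simp add: sum.distrib of_bool_def if_distrib[of "\<lambda>x. x * _"] sum.delta cong: if_cong)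
    also have "\<dots> = \<mu> * c + \<mu>\<^sup>2 * c"
      by (simp add: \<mu>_def algebra_simps power2_eq_square)
    finally show ?thesis .
  qed
  have var: "(\<Sum>\<omega>\<in>\<Omega>. (X \<omega> - \<mu>)\<^sup>2) \<le> \<mu> * c"
  proof -
    have "(\<Sum>\<omega>\<in>\<Omega>. (X \<omega> - \<mu>)\<^sup>2) = (\<Sum>\<omega>\<in>\<Omega>. (X \<omega>)\<^sup>2) - 2 * \<mu> * (\<Sum>\<omega>\<in>\<Omega>. X \<omega>) + \<mu>\<^sup>2 * c"
    proof -
      have "(\<Sum>\<omega>\<in>\<Omega>. (X \<omega> - \<mu>)\<^sup>2) = (\<Sum>\<omega>\<in>\<Omega>. (X \<omega>)\<^sup>2 - 2 * \<mu> * X \<omega> + \<mu>\<^sup>2)"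
        by (simp add: power2_diff algebra_simps)
      then show ?thesis
        by (simp add: sum.distrib sum_subtractf c_def flip: sum_distrib_left)
    qed
    then show ?thesis using m2 unfolding m1 by (simp add: power2_eq_square)
  qed
  have "real (card B) * \<mu> \<le> 4 * real k * c"
  \<comment> \<open>For small \<mu> the trivial bound card B \<le> c is enough. Otherwise X < k <
    \<mu>/4 on \<open>B\<close>, so the deviation there is at least 3\<mu>/4 and the variance bound
    yields the constant 16/9, which is below 4k.\<close>
  proof (cases "\<mu> \<le> 4 * real k")
    case True
    then have "real (card B) * \<mu> \<le> c * (4 * real k)"
      using cB mu0 by (intro mult_mono) auto
    then show ?thesis by (simp add: mult_ac)
  next
    case False
    then have mu: "\<mu> > 4 * real k" by simp
    have "real (card B) * (3 / 4 * \<mu>)\<^sup>2 = (\<Sum>\<omega>\<in>B. (3 / 4 * \<mu>)\<^sup>2)" by simp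
    also have "\<dots> \<le> (\<Sum>\<omega>\<in>B. (X \<omega> - \<mu>)\<^sup>2)"
    proof (intro sum_mono)
      fix \<omega> assume "\<omega> \<in> B"
      then have "X \<omega> < real k" by (simp add: B_def X_def)
      then have "3 / 4 * \<mu> \<le> \<mu> - X \<omega>" using mu by simp
      then have "(3 / 4 * \<mu>)\<^sup>2 \<le> (\<mu> - X \<omega>)\<^sup>2" using mu0 by (intro power_mono) auto
      then show "(3 / 4 * \<mu>)\<^sup>2 \<le> (X \<omega> - \<mu>)\<^sup>2" by (simp add: power2_commute)
    qed
    also have "\<dots> \<le> (\<Sum>\<omega>\<in>\<Omega>. (X \<omega> - \<mu>)\<^sup>2)"
      using B assms(1) by (intro sum_mono2) auto
    also note var
    finally have "\<mu> * (real (card B) * \<mu> * (9 / 16)) \<le> \<mu> * c"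
      by (simp add: power2_eq_square algebra_simps)
    moreover have "\<mu> > 0" using mu assms(4) by simp
    ultimately have "real (card B) * \<mu> * (9 / 16) \<le> c" by (simp only: mult_le_cancel_left_pos)
    moreover have "c \<le> real k * c" using assms(4) by (simp add: c_def mult_le_cancel_right1)
    moreover have "c \<ge> 0" by (simp add: c_def)
    ultimately show ?thesis by linarith
  qed
  then show ?thesis by (simp add: B_def \<mu>_def c_def)
qed

section \<open>Neighbourhoods and pebbling moves\<close>

definition neighbours :: "'a pair_pre_digraph \<Rightarrow> 'a \<Rightarrow> 'a set" where
  "neighbours G v = {u. (v, u) \<in> parcs G}"

lemma neighbours_subset:
  assumes "pair_graph G"
  shows "neighbours G v \<subseteq> pverts G"
proof -
  interpret pair_graph G by fact
  show ?thesis using arc_snd_in_verts by (force simp: neighbours_def)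
qed

lemma neighbours_sym:
  assumes "pair_graph G"
  shows "u \<in> neighbours G v \<longleftrightarrow> v \<in> neighbours G u"
proof -
  interpret pair_graph G by fact
  show ?thesis using pair_sym_arcs by (auto simp: neighbours_def symmetric_def elim: symE)
qed

lemma not_in_neighbours_self:
  assumes "pair_graph G"
  shows "v \<notin> neighbours G v"
proof -
  interpret pair_graph G by fact
  show ?thesis using pair_no_loops by (force simp: neighbours_def)
qed

lemma out_degree_eq_card_neighbours: "out_degree (with_proj G) v = card (neighbours G v)"
proof -
  have "out_arcs (with_proj G) v = Pair v ` neighbours G v"
    by (auto simp: neighbours_def image_def)
  then show ?thesis
    by (simp add: out_degree_def card_image inj_on_def)
qed

text \<open>Each vertex of \<open>D\<close> sends one pebble to \<open>x\<close>. The clause on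
  vertices outside \<open>insert x D\<close> is what the induction needs: the next donor still has
  its two pebbles.\<close>

lemma gather_pebbles:
  assumes "finite D" "\<And>v. v \<in> D \<Longrightarrow> (v, x) \<in> parcs G" "x \<notin> D" "\<And>v. v \<in> D \<Longrightarrow> 2 \<le> C v"
  shows "\<exists>C'. (pebbling_step G)\<^sup>*\<^sup>* C C' \<and> C x + card D \<le> C' x \<and> (\<forall>v. v \<notin> insert x D \<longrightarrow> C' v = C v)"
  using assms
proof (induction D rule: finite_induct)
  case empty
  then show ?case by auto
next
  case (insert v D)
  then obtain C' where C': "(pebbling_step G)\<^sup>*\<^sup>* C C'" "C x + card D \<le> C' x"
    "\<And>u. u \<notin> insert x D \<Longrightarrow> C' u = C u"
    by auto
  have "C' v = C v" using insert.hyps insert.prems by (intro C'(3)) auto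
  define C'' where "C'' = C'(v := C' v - 2, x := C' x + 1)"
  have "pebbling_step G C' C''"
    unfolding C''_def using insert.prems \<open>C' v = C v\<close> by (intro pebbling_step.intros) auto
  with C'(1) have "(pebbling_step G)\<^sup>*\<^sup>* C C''"
    by simp
  moreover have "C x + card (insert v D) \<le> C'' x" "\<forall>u. u \<notin> insert x (insert v D) \<longrightarrow> C'' u = C u"
    using C'(2,3) insert.hyps by (auto simp: C''_def)
  ultimately show ?case by blast
qed

text \<open>Four doubled neighbours bring four pebbles to \<open>x\<close>, these bring two to the
  common neighbour \<open>w\<close>, and those bring one to \<open>r\<close>.\<close>

lemma root_solvable_of_doubled_neighbours:
  assumes "pair_graph G" and w: "w \<in> neighbours G x" "w \<in> neighbours G r"
    and D: "4 \<le> card {v \<in> neighbours G x. 2 \<le> C v}"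
  shows "root_solvable G r C"
proof -
  define D where "D = {v \<in> neighbours G x. 2 \<le> C v}"
  have fin: "finite D"
    using D by (intro card_ge_0_finite) (simp add: D_def)
  have arcs: "(x, w) \<in> parcs G" "(w, r) \<in> parcs G"
    using w neighbours_sym[OF assms(1), of w r] by (auto simp: neighbours_def)
  have "\<exists>C'. (pebbling_step G)\<^sup>*\<^sup>* C C' \<and> C x + card D \<le> C' x \<and> (\<forall>v. v \<notin> insert x D \<longrightarrow> C' v = C v)"
  proof (rule gather_pebbles[OF fin])
    show "(v, x) \<in> parcs G" if "v \<in> D" for v
      using that neighbours_sym[OF assms(1), of v x] by (auto simp: D_def neighbours_def)
  qed (use not_in_neighbours_self[OF assms(1)] in \<open>auto simp: D_def\<close>)
  then obtain C1 where C1: "(pebbling_step G)\<^sup>*\<^sup>* C C1" "4 \<le> C1 x"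
    using D by (auto simp: D_def)
  \<comment> \<open>Only \<open>C1 x\<close> is known here, since \<open>w\<close> may itself have
    been a donor; hence both pebbles required at \<open>w\<close> come from \<open>x\<close>. The
    case r = x is included.\<close>
  define C2 where "C2 = C1(x := C1 x - 2, w := C1 w + 1)"
  define C3 where "C3 = C2(x := C2 x - 2, w := C2 w + 1)"
  define C4 where "C4 = C3(w := C3 w - 2, r := C3 r + 1)"
  have wx: "w \<noteq> x" using w(1) not_in_neighbours_self[OF assms(1)] by auto
  have "pebbling_step G C1 C2"
    unfolding C2_def using arcs C1(2) by (intro pebbling_step.intros) auto
  moreover have "pebbling_step G C2 C3"
    unfolding C3_def using arcs C1(2) wx by (intro pebbling_step.intros) (auto simp: C2_def)
  moreover have "pebbling_step G C3 C4"
    unfolding C4_def using arcs wx by (intro pebbling_step.intros) (auto simp: C3_def C2_def)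
  ultimately have "(pebbling_step G)\<^sup>*\<^sup>* C C4"
    using C1(1) by simp
  moreover have "1 \<le> C4 r" by (simp add: C4_def)
  ultimately show ?thesis unfolding root_solvable_def by blast
qed

text \<open>Greedy choice: a vertex joins \<open>A\<close> exactly when its set is disjoint from all
  sets chosen so far. A vertex that joins is its own witness, because its set is nonempty.\<close>

lemma exists_maximal_disjoint_subfamily:
  assumes "finite V" "\<And>v. v \<in> V \<Longrightarrow> N v \<noteq> {}"
  shows "\<exists>A\<subseteq>V. disjoint_family_on N A \<and> (\<forall>r\<in>V. \<exists>x\<in>A. N r \<inter> N x \<noteq> {})"
  using assms
proof (induction V rule: finite_induct)
  case empty
  then show ?case by (auto simp: disjoint_family_on_def)
next
  case (insert v V)
  then obtain A where A: "A \<subseteq> V" "disjoint_family_on N A" "\<forall>r\<in>V. \<exists>x\<in>A. N r \<inter> N x \<noteq> {}"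
    by auto
  show ?case
  proof (cases "\<exists>x\<in>A. N v \<inter> N x \<noteq> {}")
    case True
    then show ?thesis using A by (intro exI[of _ A]) auto
  next
    case False
    then have "disjoint_family_on N (insert v A)"
      using A(2) by (auto simp: disjoint_family_on_def)
    moreover have "\<forall>r\<in>insert v V. \<exists>x\<in>insert v A. N r \<inter> N x \<noteq> {}"
      using A(3) insert.prems by auto
    ultimately show ?thesis using A(1) by (intro exI[of _ "insert v A"]) auto
  qed
qed

section \<open>The union bound over neighbourhood centres\<close>

text \<open>There are at most n / d centres, and each fails to have four doubled neighbours with
  probability at most 16 / (p d), where p is the doubling probability; this is how d comes to be
  squared.\<close>

lemma card_unsolvable_le:
  assumes G: "pair_graph G" and d: "0 < d" "\<And>v. v \<in> pverts G \<Longrightarrow> d \<le> real (card (neighbours G v))"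
    and n: "2 \<le> card (pverts G)"
  shows "real (card {C \<in> configurations G t. \<not> solvable G C}) * (doubled_prob (card (pverts G)) t * d\<^sup>2) \<le>
    16 * real (card (pverts G)) * real (card (configurations G t))"
proof -
  interpret pair_graph G by fact
  define p where "p = doubled_prob (card (pverts G)) t"
  define \<Omega> where "\<Omega> = configurations G t"
  define B where "B = (\<lambda>x. {C \<in> \<Omega>. card {v \<in> neighbours G x. 2 \<le> C v} < 4})"
  have fin: "finite \<Omega>" unfolding \<Omega>_def by (intro finite_configurations pair_finite_verts)
  have p: "0 \<le> p" unfolding p_def by (rule doubled_prob_nonneg[OF n])
  have sub: "neighbours G x \<subseteq> pverts G" for x by (rule neighbours_subset[OF G])
  have finN: "finite (neighbours G x)" for x using sub pair_finite_verts by (rule finite_subset)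
  have nonempty: "neighbours G v \<noteq> {}" if "v \<in> pverts G" for v
    using d(2)[OF that] d(1) by auto
  obtain A where A: "A \<subseteq> pverts G" "disjoint_family_on (neighbours G) A"
    "\<And>r. r \<in> pverts G \<Longrightarrow> \<exists>x\<in>A. neighbours G r \<inter> neighbours G x \<noteq> {}"
    using exists_maximal_disjoint_subfamily[of "pverts G" "neighbours G", OF pair_finite_verts nonempty]
    by blast
  have finA: "finite A" using A(1) pair_finite_verts by (rule finite_subset)
  \<comment> \<open>The disjoint neighbourhoods, each of size at least \<open>d\<close>, are packed
    into the vertex set.\<close>
  have cardA: "real (card A) * d \<le> real (card (pverts G))"
  proof -
    have "real (card A) * d = (\<Sum>x\<in>A. d)" by simp
    also have "\<dots> \<le> (\<Sum>x\<in>A. real (card (neighbours G x)))"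
      using A(1) d(2) by (intro sum_mono) auto
    also have "\<dots> = real (card (\<Union>x\<in>A. neighbours G x))"
      using A(2) finA finN by (subst card_UN_disjoint) (auto simp: disjoint_family_on_def)
    also have "\<dots> \<le> real (card (pverts G))"
      using sub pair_finite_verts by (intro of_nat_mono card_mono) auto
    finally show ?thesis .
  qed
  have cardB: "real (card (B x)) * (p * d) \<le> 16 * real (card \<Omega>)" if "x \<in> A" for x
  proof -
    have "real (card (B x)) * (p * d) \<le> real (card (B x)) * (p * real (card (neighbours G x)))"
      using p d(2) A(1) that by (intro mult_left_mono) auto
    \<comment> \<open>Chebyshev with k = 4, the number of doubled neighbours that reaches every root
      within distance two.\<close>
    also have "\<dots> \<le> 4 * real 4 * real (card \<Omega>)"
      unfolding B_def
    proof (rule second_moment_count[OF fin finN p])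
      fix v assume "v \<in> neighbours G x"
      then show "real (card {C \<in> \<Omega>. 2 \<le> C v}) = p * real (card \<Omega>)"
        unfolding p_def \<Omega>_def using sub pair_finite_verts n by (intro card_doubled) auto
    next
      fix u v assume "u \<in> neighbours G x" "v \<in> neighbours G x" "u \<noteq> v"
      then show "real (card {C \<in> \<Omega>. 2 \<le> C u \<and> 2 \<le> C v}) \<le> p\<^sup>2 * real (card \<Omega>)"
        unfolding p_def \<Omega>_def using sub pair_finite_verts by (intro card_doubled_pair_le) auto
    qed simp
    finally show ?thesis by simp
  qed
  \<comment> \<open>By maximality an unreachable root shares a neighbour with some centre, so this
    centre must lack four doubled neighbours.\<close>
  have "{C \<in> \<Omega>. \<not> solvable G C} \<subseteq> (\<Union>x\<in>A. B x)"
  proof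
    fix C assume C: "C \<in> {C \<in> \<Omega>. \<not> solvable G C}"
    then obtain r where r: "r \<in> pverts G" "\<not> root_solvable G r C"
      by (auto simp: solvable_def)
    obtain x w where x: "x \<in> A" "w \<in> neighbours G r" "w \<in> neighbours G x"
      using A(3)[OF r(1)] by blast
    have "\<not> 4 \<le> card {v \<in> neighbours G x. 2 \<le> C v}"
      using root_solvable_of_doubled_neighbours[OF G x(3,2)] r(2) by blast
    then show "C \<in> (\<Union>x\<in>A. B x)" using x(1) C by (auto simp: B_def not_le)
  qed
  then have "card {C \<in> \<Omega>. \<not> solvable G C} \<le> card (\<Union>x\<in>A. B x)"
    using finA fin by (intro card_mono) (auto simp: B_def)
  also have "\<dots> \<le> (\<Sum>x\<in>A. card (B x))" by (rule card_UN_le[OF finA])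
  finally have "real (card {C \<in> \<Omega>. \<not> solvable G C}) \<le> (\<Sum>x\<in>A. real (card (B x)))"
    by (simp flip: of_nat_sum)
  then have "real (card {C \<in> \<Omega>. \<not> solvable G C}) * (p * d) \<le> (\<Sum>x\<in>A. real (card (B x))) * (p * d)"
    using p d(1) by (intro mult_right_mono) auto
  also have "\<dots> \<le> (\<Sum>x\<in>A. 16 * real (card \<Omega>))"
    unfolding sum_distrib_right by (intro sum_mono cardB)
  finally have "real (card {C \<in> \<Omega>. \<not> solvable G C}) * (p * d) * d \<le> (real (card A) * (16 * real (card \<Omega>))) * d"
    using d(1) by (intro mult_right_mono) auto
  also have "\<dots> = 16 * real (card \<Omega>) * (real (card A) * d)" by simp
  also have "\<dots> \<le> 16 * real (card \<Omega>) * real (card (pverts G))"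
    by (intro mult_left_mono cardA) auto
  finally show ?thesis
    by (simp add: p_def \<Omega>_def power2_eq_square mult_ac)
qed

section \<open>Explicit bounds on the probability of solvability\<close>

text \<open>The two summands belong to the regimes t \<le> n and t > n. Their sum is valid for all t
  \<ge> 2, as needed for pebble numbers with no upper limit.\<close>

lemma inverse_doubled_prob_le:
  assumes "2 \<le> n" "2 \<le> t"
  shows "0 < doubled_prob n t" "1 / doubled_prob n t \<le> 8 * (real n)\<^sup>2 / (real t)\<^sup>2 + 4"
proof -
  define x y where "x = real n" and "y = real t"
  have xy: "x \<ge> 2" "y \<ge> 2" using assms by (auto simp: x_def y_def)
  show "0 < doubled_prob n t"
    using xy unfolding doubled_prob_def x_def[symmetric] y_def[symmetric] by simp
  have eq: "1 / doubled_prob n t = ((x + y - 1) / y) * ((x + y - 2) / (y - 1))"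
    by (simp add: doubled_prob_def x_def y_def)
  show "1 / doubled_prob n t \<le> 8 * (real n)\<^sup>2 / (real t)\<^sup>2 + 4"
  proof (cases "y \<le> x")
    case True
    have "(x + y - 1) / y \<le> 2 * x / y"
      using xy True by (intro divide_right_mono) auto
    \<comment> \<open>Here y / 2 \<le> y - 1 because y \<ge> 2; this turns the constant 4 into
      8.\<close>
    moreover have "(x + y - 2) / (y - 1) \<le> 2 * x / (y / 2)"
      using xy True by (intro frac_le) auto
    ultimately have "1 / doubled_prob n t \<le> (2 * x / y) * (2 * x / (y / 2))"
      unfolding eq using xy by (intro mult_mono) auto
    also have "\<dots> = 8 * x\<^sup>2 / y\<^sup>2" by (simp add: power2_eq_square)
    finally show ?thesis by (simp add: x_def y_def)
  next
    case False
    have "(x + y - 1) / y \<le> 2" "(x + y - 2) / (y - 1) \<le> 2"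
      using xy False by (auto simp: field_simps)
    then have "1 / doubled_prob n t \<le> 2 * 2"
      unfolding eq using xy by (intro mult_mono) auto
    moreover have "0 \<le> 8 * (real n)\<^sup>2 / (real t)\<^sup>2" by simp
    ultimately show ?thesis by linarith
  qed
qed

lemma solvable_prob_eq:
  assumes "finite (pverts G)" "pverts G \<noteq> {}"
  shows "solvable_prob G t = real (card {C \<in> configurations G t. solvable G C}) / real (card (configurations G t))"
  unfolding solvable_prob_def
  by (subst measure_pmf_of_set) (simp_all add: assms configurations_nonempty finite_configurations Int_def)

text \<open>The union bound with 1 / p estimated from above. The first term is small for t well
  above n^(3/2) / d, and the second one, free of t, is small when d is well above the square root of
  n.\<close>

lemma solvable_prob_ge:
  assumes G: "G \<in> connected_graphs_min_degree n d" and "0 < d" "2 \<le> n" "2 \<le> t"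
  shows "1 - solvable_prob G t \<le> 128 * real n ^ 3 / (d\<^sup>2 * (real t)\<^sup>2) + 64 * real n / d\<^sup>2"
proof -
  have pg: "pair_graph G" and n: "card (pverts G) = n"
    and deg: "\<And>v. v \<in> pverts G \<Longrightarrow> d \<le> real (card (neighbours G v))"
    using G by (auto simp: connected_graphs_min_degree_def out_degree_eq_card_neighbours)
  interpret pair_graph G by fact
  define p where "p = doubled_prob n t"
  define c where "c = real (card (configurations G t))"
  define b where "b = real (card {C \<in> configurations G t. \<not> solvable G C})"
  have ne: "pverts G \<noteq> {}" using n assms by auto
  have c: "c > 0"
    using configurations_nonempty[OF pair_finite_verts ne] finite_configurations[OF pair_finite_verts]
    by (simp add: c_def card_gt_0_iff)
  have p: "0 < p" "1 / p \<le> 8 * (real n)\<^sup>2 / (real t)\<^sup>2 + 4"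
    unfolding p_def using inverse_doubled_prob_le assms by auto
  have "card (configurations G t) = card {C \<in> configurations G t. solvable G C} +
    card {C \<in> configurations G t. \<not> solvable G C}"
    using finite_configurations[OF pair_finite_verts]
    by (subst card_Un_disjoint[symmetric]) (auto intro: arg_cong[where f = card])
  then have "1 - solvable_prob G t = b / c"
    using c by (simp add: solvable_prob_eq pair_finite_verts ne b_def c_def field_simps)
  also have "\<dots> \<le> 16 * real n / (p * d\<^sup>2)"
    using card_unsolvable_le[OF pg \<open>0 < d\<close> deg, of t] assms c p(1)
    by (simp add: n b_def c_def p_def field_simps)
  also have "\<dots> = 16 * real n / d\<^sup>2 * (1 / p)" by simp
  also have "\<dots> \<le> 16 * real n / d\<^sup>2 * (8 * (real n)\<^sup>2 / (real t)\<^sup>2 + 4)"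
    by (intro mult_left_mono p(2)) auto
  also have "\<dots> = 128 * real n ^ 3 / (d\<^sup>2 * (real t)\<^sup>2) + 64 * real n / d\<^sup>2"
    by (simp add: algebra_simps power2_eq_square power3_eq_cube)
  finally show ?thesis .
qed

text \<open>Without a doubled vertex no step can be made, and fewer pebbles than vertices leave some
  vertex empty.\<close>

lemma not_solvable_of_le_1:
  assumes "finite (pverts G)" "C \<in> configurations G t" "t < card (pverts G)" "\<And>v. C v \<le> 1"
  shows "\<not> solvable G C"
proof -
  have "C' = C" if "(pebbling_step G)\<^sup>*\<^sup>* C C'" for C'
    using that
  proof (induction rule: rtranclp_induct)
    case (step C' C'')
    from step.hyps(2) obtain u where "2 \<le> C' u" by (auto elim: pebbling_step.cases)
    then show ?case using step.IH assms(4)[of u] by simp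
  qed simp
  moreover have "\<exists>r\<in>pverts G. C r = 0"
  proof (rule ccontr)
    assume "\<not> (\<exists>r\<in>pverts G. C r = 0)"
    then have "(\<Sum>v\<in>pverts G. 1) \<le> (\<Sum>v\<in>pverts G. C v)"
      by (intro sum_mono) (auto simp: Suc_le_eq)
    then show False using assms(2,3) by (simp add: configurations_def)
  qed
  ultimately show ?thesis
    by (metis not_one_le_zero root_solvable_def solvable_def)
qed

lemma doubled_prob_le:
  assumes "2 \<le> n"
  shows "doubled_prob n t \<le> (real t)\<^sup>2 / (real n)\<^sup>2"
proof (cases "t < 2")
  case True
  then have "t = 0 \<or> t = 1" by auto
  then show ?thesis by (auto simp: doubled_prob_def)
next
  case False
  \<comment> \<open>Since t \<ge> 2, both factors of the denominator are at least n.\<close>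
  then have "doubled_prob n t \<le> real t * real t / (real n * real n)"
    unfolding doubled_prob_def using assms by (intro frac_le mult_mono) auto
  then show ?thesis by (simp add: power2_eq_square)
qed

text \<open>For t < n solvability requires a doubled vertex, and the union bound over n vertices
  gives n (t/n)^2. For t \<ge> n the right side is at least 1.\<close>

lemma solvable_prob_le:
  assumes "finite (pverts G)" "card (pverts G) = n" "2 \<le> n"
  shows "solvable_prob G t \<le> (real t)\<^sup>2 / real n"
proof (cases "t < n")
  case True
  define \<Omega> where "\<Omega> = configurations G t"
  have ne: "pverts G \<noteq> {}" using assms by auto
  have fin: "finite \<Omega>" unfolding \<Omega>_def by (intro finite_configurations assms)
  have c: "card \<Omega> > 0"
    using configurations_nonempty[OF assms(1) ne] fin by (simp add: \<Omega>_def card_gt_0_iff)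
  have "{C \<in> \<Omega>. solvable G C} \<subseteq> (\<Union>v\<in>pverts G. {C \<in> \<Omega>. 2 \<le> C v})"
  proof
    fix C assume C: "C \<in> {C \<in> \<Omega>. solvable G C}"
    then have "\<exists>v. \<not> C v \<le> 1"
      using not_solvable_of_le_1[OF assms(1), of C t] True assms(2) by (auto simp: \<Omega>_def)
    then obtain v where "\<not> C v \<le> 1" by blast
    then have v: "2 \<le> C v" by simp
    then have "v \<in> pverts G"
      using C by (auto simp: \<Omega>_def configurations_def intro: ccontr)
    then show "C \<in> (\<Union>v\<in>pverts G. {C \<in> \<Omega>. 2 \<le> C v})" using v C by blast
  qed
  then have "card {C \<in> \<Omega>. solvable G C} \<le> card (\<Union>v\<in>pverts G. {C \<in> \<Omega>. 2 \<le> C v})"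
    using assms(1) fin by (intro card_mono) auto
  also have "\<dots> \<le> (\<Sum>v\<in>pverts G. card {C \<in> \<Omega>. 2 \<le> C v})" by (rule card_UN_le[OF assms(1)])
  finally have "real (card {C \<in> \<Omega>. solvable G C}) \<le> (\<Sum>v\<in>pverts G. real (card {C \<in> \<Omega>. 2 \<le> C v}))"
    by (simp flip: of_nat_sum)
  also have "\<dots> = (\<Sum>v\<in>pverts G. doubled_prob n t * real (card \<Omega>))"
    using card_doubled[OF assms(1)] assms by (intro sum.cong) (auto simp: \<Omega>_def)
  also have "\<dots> = real n * doubled_prob n t * real (card \<Omega>)"
    using assms by simp
  also have "\<dots> \<le> real n * ((real t)\<^sup>2 / (real n)\<^sup>2) * real (card \<Omega>)"
    by (intro mult_right_mono mult_left_mono doubled_prob_le assms) auto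
  also have "\<dots> = (real t)\<^sup>2 / real n * real (card \<Omega>)"
    using assms by (simp add: power2_eq_square)
  finally show ?thesis
    using c by (simp add: solvable_prob_eq assms ne pos_divide_le_eq flip: \<Omega>_def)
next
  case False
  have "solvable_prob G t \<le> 1" by (simp add: solvable_prob_def)
  also have "1 \<le> real t * (real t / real n)"
    using False assms mult_mono[of 1 "real t" 1 "real t / real n"] by simp
  finally show ?thesis by (simp add: power2_eq_square)
qed

section \<open>From probability bounds to thresholds, along subsequences\<close>

text \<open>Every constant \<open>k\<close> fails at arbitrarily large indices, so the failures can
  be picked in increasing order with the k-th index defeating the constant k.\<close>

lemma not_bigo_subseq:
  fixes f g :: "nat \<Rightarrow> real"
  assumes "f \<notin> O(g)"
  shows "\<exists>h. strict_mono h \<and> (\<forall>k. real k * \<bar>g (h k)\<bar> < \<bar>f (h k)\<bar>)"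
proof -
  have ex: "\<exists>n\<ge>N. real k * \<bar>g n\<bar> < \<bar>f n\<bar>" for k N
  proof (rule ccontr)
    assume "\<not> (\<exists>n\<ge>N. real k * \<bar>g n\<bar> < \<bar>f n\<bar>)"
    then have "\<forall>n\<ge>N. norm (f n) \<le> real k * norm (g n)"
      by (auto simp: not_less)
    then have "f \<in> O(g)"
      by (intro bigoI[of _ "real k"]) (auto simp: eventually_sequentially)
    with assms show False by contradiction
  qed
  have "\<exists>h. \<forall>k. real k * \<bar>g (h k)\<bar> < \<bar>f (h k)\<bar> \<and> h k < h (Suc k)"
  proof (rule dependent_nat_choice)
    show "\<exists>n. real 0 * \<bar>g n\<bar> < \<bar>f n\<bar>" using ex[of 0 0] by blast
    show "\<exists>m. real (Suc k) * \<bar>g m\<bar> < \<bar>f m\<bar> \<and> n < m" for k n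
      using ex[of "Suc n" "Suc k"] Suc_le_lessD by blast
  qed
  then show ?thesis by (auto simp: strict_mono_Suc_iff)
qed

text \<open>For functions defined differently on and off a subsequence: the ratio decays like 1/k at
  the index \<open>h k\<close> and like 1/n at the remaining indices.\<close>

lemma smallo_subseqI:
  fixes a b :: "nat \<Rightarrow> real"
  assumes h: "strict_mono h" and C: "0 < C"
    and on: "\<forall>\<^sub>F k in sequentially. real k * \<bar>a (h k)\<bar> \<le> C * \<bar>b (h k)\<bar>"
    and off: "\<And>n. n \<notin> range h \<Longrightarrow> real n * \<bar>a n\<bar> \<le> C * \<bar>b n\<bar>"
  shows "a \<in> o(b)"
proof (rule landau_o.smallI)
  fix e :: real assume e: "e > 0"
  obtain k1 where k1: "\<And>k. k \<ge> k1 \<Longrightarrow> real k * \<bar>a (h k)\<bar> \<le> C * \<bar>b (h k)\<bar>"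
    using on by (auto simp: eventually_sequentially)
  obtain k2 :: nat where k2: "C / e < real k2" using reals_Archimedean2 by blast
  have small: "norm (a n) \<le> e * norm (b n)" if "real k * \<bar>a n\<bar> \<le> C * \<bar>b n\<bar>" "k \<ge> k2" for n k
  proof -
    have Ck: "C / e \<le> real k" using k2 that(2) by linarith
    have "C / e * \<bar>a n\<bar> \<le> real k * \<bar>a n\<bar>" by (intro mult_right_mono Ck) auto
    then have "C / e * \<bar>a n\<bar> \<le> C * \<bar>b n\<bar>" using that(1) by linarith
    then show ?thesis using e C by (simp add: field_simps)
  qed
  have "norm (a n) \<le> e * norm (b n)" if n: "n \<ge> h (max k1 k2)" "n \<ge> k2" for n
  proof (cases "n \<in> range h")
    case True
    then obtain k where k: "n = h k" by blast
    then have "k \<ge> max k1 k2" using n(1) h by (simp add: strict_mono_less_eq)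
    then show ?thesis using small[OF k1, of k] k by auto
  next
    case False
    then show ?thesis using small[OF off n(2)] by blast
  qed
  then show "\<forall>\<^sub>F n in sequentially. norm (a n) \<le> e * norm (b n)"
    by (intro eventually_sequentiallyI[of "max (h (max k1 k2)) k2"]) auto
qed

text \<open>If \<open>\<tau>\<close> were not O(f), some \<open>t\<close> would be far below
  \<open>\<tau>\<close> and yet at least \<open>K * f\<close> on a subsequence; the threshold
  property and \<open>ub\<close> then contradict each other there.\<close>

lemma threshold_le_of_solvable:
  assumes th: "\<tau> \<in> pebbling_thresholds \<G>"
    and f: "\<forall>\<^sub>F n in sequentially. 1 \<le> f n" and K: "0 \<le> K"
    and ub: "\<forall>\<^sub>F n in sequentially. \<forall>t. K * f n \<le> real t \<longrightarrow> 1 / 2 \<le> solvable_prob (\<G> n) t"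
  shows "\<tau> \<in> O(f)"
proof (rule ccontr)
  assume "\<tau> \<notin> O(f)"
  then obtain h where h: "strict_mono h" "\<And>k. real k * \<bar>f (h k)\<bar> < \<bar>\<tau> (h k)\<bar>"
    using not_bigo_subseq by blast
  have hlim: "filterlim h sequentially sequentially" by (rule filterlim_subseq[OF h(1)])
  \<comment> \<open>Thresholds are tested on functions of all n. The value 0 off the subsequence
    keeps \<open>t\<close> below \<open>\<tau>\<close>; the ceiling costs at most 1, which is at
    most \<open>f n\<close>.\<close>
  define t where "t = (\<lambda>n. if n \<in> range h then nat \<lceil>K * f n\<rceil> else 0)"
  have "(\<lambda>n. real (t n)) \<in> o(\<tau>)"
  proof (rule smallo_subseqI[OF h(1)])
    show "0 < K + 1" using K by simp
    have "\<forall>\<^sub>F k in sequentially. 1 \<le> f (h k)"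
      by (rule eventually_compose_filterlim[OF f hlim])
    then show "\<forall>\<^sub>F k in sequentially. real k * \<bar>real (t (h k))\<bar> \<le> (K + 1) * \<bar>\<tau> (h k)\<bar>"
    proof (rule eventually_mono)
      fix k assume f1: "1 \<le> f (h k)"
      have "real (t (h k)) \<le> K * f (h k) + 1"
        using K f1 by (simp add: t_def)
      also have "\<dots> \<le> (K + 1) * f (h k)" using f1 by (simp add: algebra_simps)
      finally have "real k * real (t (h k)) \<le> real k * ((K + 1) * f (h k))"
        by (intro mult_left_mono) auto
      also have "\<dots> = (K + 1) * (real k * \<bar>f (h k)\<bar>)" using f1 by simp
      also have "\<dots> \<le> (K + 1) * \<bar>\<tau> (h k)\<bar>"
        using h(2)[of k] K by (intro mult_left_mono) auto
      finally show "real k * \<bar>real (t (h k))\<bar> \<le> (K + 1) * \<bar>\<tau> (h k)\<bar>" by simp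
    qed
  qed (use K in \<open>auto simp: t_def\<close>)
  then have "(\<lambda>n. solvable_prob (\<G> n) (t n)) \<longlonglongrightarrow> 0"
    using th by (auto simp: pebbling_thresholds_def)
  then have "\<forall>\<^sub>F n in sequentially. solvable_prob (\<G> n) (t n) < 1 / 2"
    by (rule order_tendstoD) simp
  then have "\<forall>\<^sub>F k in sequentially. solvable_prob (\<G> (h k)) (t (h k)) < 1 / 2"
    by (rule eventually_compose_filterlim[OF _ hlim])
  moreover have "\<forall>\<^sub>F k in sequentially. \<forall>t. K * f (h k) \<le> real t \<longrightarrow> 1 / 2 \<le> solvable_prob (\<G> (h k)) t"
    by (rule eventually_compose_filterlim[OF ub hlim])
  ultimately have "\<forall>\<^sub>F k in sequentially. False"
  proof eventually_elim
    case (elim k)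
    have "K * f (h k) \<le> real (t (h k))"
      by (simp add: t_def) linarith
    then show False using elim by fastforce
  qed
  then show False by simp
qed

text \<open>The dual argument: \<open>t\<close> is far above \<open>\<tau>\<close> but at most
  \<open>K * f\<close> on a subsequence.\<close>

lemma threshold_ge_of_unsolvable:
  assumes th: "\<tau> \<in> pebbling_thresholds \<G>"
    and f: "\<forall>\<^sub>F n in sequentially. 1 \<le> K * f n" and K: "0 < K"
    and lb: "\<forall>\<^sub>F n in sequentially. \<forall>t. real t \<le> K * f n \<longrightarrow> solvable_prob (\<G> n) t \<le> 1 / 2"
  shows "f \<in> O(\<tau>)"
proof (rule ccontr)
  assume "f \<notin> O(\<tau>)"
  then obtain h where h: "strict_mono h" "\<And>k. real k * \<bar>\<tau> (h k)\<bar> < \<bar>f (h k)\<bar>"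
    using not_bigo_subseq by blast
  have hlim: "filterlim h sequentially sequentially" by (rule filterlim_subseq[OF h(1)])
  \<comment> \<open>Off the subsequence the factor \<open>n\<close> makes \<open>t\<close> dominate
    \<open>\<tau>\<close>, even where \<open>\<tau>\<close> is not integral.\<close>
  define t where "t = (\<lambda>n. if n \<in> range h then nat \<lfloor>K * f n\<rfloor> else n * nat \<lceil>\<bar>\<tau> n\<bar>\<rceil>)"
  have fh: "\<forall>\<^sub>F k in sequentially. 1 \<le> K * f (h k)"
    by (rule eventually_compose_filterlim[OF f hlim])
  have "\<tau> \<in> o(\<lambda>n. real (t n))"
  proof (rule smallo_subseqI[OF h(1)])
    \<comment> \<open>The summand 2 / K serves the subsequence, where taking the floor of a number
      that is at least 1 loses at most a factor 2; the summand 1 serves the other indices.\<close>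
    show "0 < 2 / K + 1" using K by (simp add: add_pos_pos)
    show "\<forall>\<^sub>F k in sequentially. real k * \<bar>\<tau> (h k)\<bar> \<le> (2 / K + 1) * \<bar>real (t (h k))\<bar>"
      using fh
    proof (rule eventually_mono)
      fix k assume f1: "1 \<le> K * f (h k)"
      then have f0: "0 < f (h k)" using K by (smt (verit) mult_le_0_iff)
      have "1 \<le> \<lfloor>K * f (h k)\<rfloor>" using f1 by simp
      then have "real (t (h k)) = real_of_int \<lfloor>K * f (h k)\<rfloor>" "1 \<le> real (t (h k))"
        by (simp_all add: t_def)
      then have "K * f (h k) \<le> 2 * real (t (h k))" by linarith
      then have "f (h k) \<le> 2 / K * real (t (h k))"
        using K by (simp add: field_simps)
      also have "\<dots> \<le> (2 / K + 1) * real (t (h k))"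
        by (intro mult_right_mono) auto
      finally show "real k * \<bar>\<tau> (h k)\<bar> \<le> (2 / K + 1) * \<bar>real (t (h k))\<bar>"
        using h(2)[of k] f0 by simp
    qed
    show "real n * \<bar>\<tau> n\<bar> \<le> (2 / K + 1) * \<bar>real (t n)\<bar>" if "n \<notin> range h" for n
    proof -
      have "real n * \<bar>\<tau> n\<bar> \<le> real (t n)"
        using that unfolding t_def of_nat_mult by (simp add: mult_left_mono)
      also have "\<dots> \<le> (2 / K + 1) * real (t n)"
        using K by (simp add: mult_le_cancel_right1)
      finally show ?thesis by simp
    qed
  qed
  then have "(\<lambda>n. solvable_prob (\<G> n) (t n)) \<longlonglongrightarrow> 1"
    using th by (auto simp: pebbling_thresholds_def)
  then have "\<forall>\<^sub>F n in sequentially. 1 / 2 < solvable_prob (\<G> n) (t n)"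
    by (rule order_tendstoD) simp
  then have "\<forall>\<^sub>F k in sequentially. 1 / 2 < solvable_prob (\<G> (h k)) (t (h k))"
    by (rule eventually_compose_filterlim[OF _ hlim])
  moreover have "\<forall>\<^sub>F k in sequentially. \<forall>t. real t \<le> K * f (h k) \<longrightarrow> solvable_prob (\<G> (h k)) t \<le> 1 / 2"
    by (rule eventually_compose_filterlim[OF lb hlim])
  ultimately have "\<forall>\<^sub>F k in sequentially. False"
    using fh
  proof eventually_elim
    case (elim k)
    have "real (t (h k)) \<le> K * f (h k)"
      using elim(3) by (simp add: t_def)
    then show False using elim by fastforce
  qed
  then show False by simp
qed

lemma solvable_prob_le_1: "solvable_prob G t \<le> 1"
  by (simp add: solvable_prob_def)

lemma solvable_prob_nonneg: "0 \<le> solvable_prob G t"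
  by (simp add: solvable_prob_def)

section \<open>Asymptotics and the theorem\<close>

text \<open>The first claim follows from \<delta> \<le> n. In the second, \<epsilon> = 1/2 suffices
  for the upper bound on thresholds, whereas convergence to 1 in the dense case takes all
  \<epsilon>.\<close>

lemma eventually_solvable_prob_ge:
  fixes \<delta> :: "nat \<Rightarrow> real"
  assumes nonneg: "\<forall>\<^sub>F n in sequentially. 0 \<le> \<delta> n"
    and small: "(\<lambda>n. sqrt (real n)) \<in> o(\<delta>)"
    and le: "\<forall>n\<ge>1. \<delta> n \<le> real n - 1"
    and G: "\<forall>n\<ge>1. \<G> n \<in> connected_graphs_min_degree n (\<delta> n)"
  shows "\<forall>\<^sub>F n in sequentially. 0 < \<delta> n \<and> sqrt (real n) \<le> real n powr (3 / 2) / \<delta> n"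
    and "0 < \<epsilon> \<Longrightarrow> \<exists>K>0. \<forall>\<^sub>F n in sequentially. \<forall>t.
      K * (real n powr (3 / 2) / \<delta> n) \<le> real t \<longrightarrow> 1 - \<epsilon> \<le> solvable_prob (\<G> n) t"
proof -
  define f where "f = (\<lambda>n. real n powr (3 / 2) / \<delta> n)"
  have big: "\<forall>\<^sub>F n in sequentially. sqrt (real n) \<le> c * \<delta> n" if "c > 0" for c
    using landau_o.smallD[OF small that] nonneg by eventually_elim auto
  have f: "sqrt (real n) \<le> f n" if "0 < \<delta> n" "n \<ge> 1" for n
  proof -
    have "real n powr (3 / 2) = real n powr 1 * real n powr (1 / 2)"
      by (subst powr_add[symmetric]) simp
    also have "\<dots> = real n * sqrt (real n)" using that by (simp add: powr_half_sqrt)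
    finally have p: "real n powr (3 / 2) = real n * sqrt (real n)" .
    have "\<delta> n * sqrt (real n) \<le> real n * sqrt (real n)"
      using le that(2) by (intro mult_right_mono) force+
    then show ?thesis using that by (simp add: f_def p field_simps)
  qed
  have pos: "\<forall>\<^sub>F n in sequentially. 0 < \<delta> n"
    using big[OF zero_less_one] eventually_ge_at_top[of 1]
  proof eventually_elim
    case (elim n)
    then have "0 < sqrt (real n)" by simp
    then show ?case using elim by linarith
  qed
  then show "\<forall>\<^sub>F n in sequentially. 0 < \<delta> n \<and> sqrt (real n) \<le> real n powr (3 / 2) / \<delta> n"
    using eventually_ge_at_top[of 1] by eventually_elim (use f in \<open>auto simp: f_def\<close>)
  show "\<exists>K>0. \<forall>\<^sub>F n in sequentially. \<forall>t. K * (real n powr (3 / 2) / \<delta> n) \<le> real t \<longrightarrow>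
    1 - \<epsilon> \<le> solvable_prob (\<G> n) t" if \<epsilon>: "0 < \<epsilon>"
  proof -
    \<comment> \<open>K^2 \<ge> 256 / \<epsilon> makes the term 128 n^3 / (\<delta> t)^2 at most
      \<epsilon> / 2. K \<ge> 1 together with n \<ge> 4 gives t \<ge> f(n) \<ge> 2.\<close>
    define K where "K = max 1 (sqrt (256 / \<epsilon>))"
    have K: "1 \<le> K" "256 / \<epsilon> \<le> K\<^sup>2"
      using \<epsilon> real_sqrt_le_iff[of "256 / \<epsilon>" "K\<^sup>2"] by (auto simp: K_def)
    \<comment> \<open>The constant is chosen so that 64 n / \<delta>^2 \<le> \<epsilon> / 2.\<close>
    have "\<forall>\<^sub>F n in sequentially. sqrt (real n) \<le> sqrt (\<epsilon> / 128) * \<delta> n"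
      using \<epsilon> by (intro big) simp
    then have "\<forall>\<^sub>F n in sequentially. \<forall>t. K * f n \<le> real t \<longrightarrow> 1 - \<epsilon> \<le> solvable_prob (\<G> n) t"
      using pos eventually_ge_at_top[of 4]
    proof eventually_elim
      case (elim n)
      have sq: "(real n powr (3 / 2))\<^sup>2 = real n ^ 3"
        using elim by (simp add: powr_powr flip: powr_numeral)
      show ?case
      proof (intro allI impI)
        fix t assume t: "K * f n \<le> real t"
        have fn: "2 \<le> f n" "0 < f n"
          using f[of n] elim real_le_rsqrt[of 2 "real n"] by auto
        have "1 * f n \<le> K * f n" using K fn by (intro mult_right_mono) auto
        then have "2 \<le> real t" using fn t by linarith
        then have t2: "2 \<le> t" by simp
        have "(K * f n)\<^sup>2 \<le> (real t)\<^sup>2" using K fn t by (intro power_mono) auto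
        then have "K\<^sup>2 * real n ^ 3 \<le> (\<delta> n)\<^sup>2 * (real t)\<^sup>2"
          using elim(2) by (simp add: f_def power_mult_distrib power_divide sq field_simps)
        moreover have "256 / \<epsilon> * real n ^ 3 \<le> K\<^sup>2 * real n ^ 3"
          by (intro mult_right_mono K) auto
        ultimately have "256 / \<epsilon> * real n ^ 3 \<le> (\<delta> n)\<^sup>2 * (real t)\<^sup>2" by linarith
        then have 1: "128 * real n ^ 3 / ((\<delta> n)\<^sup>2 * (real t)\<^sup>2) \<le> \<epsilon> / 2"
          using \<epsilon> elim(2) t2 by (simp add: field_simps)
        have "(sqrt (real n))\<^sup>2 \<le> (sqrt (\<epsilon> / 128) * \<delta> n)\<^sup>2"
          using elim by (intro power_mono) auto
        then have 2: "64 * real n / (\<delta> n)\<^sup>2 \<le> \<epsilon> / 2"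
          using \<epsilon> elim(2) by (simp add: power_mult_distrib field_simps)
        have "1 - solvable_prob (\<G> n) t \<le> 128 * real n ^ 3 / ((\<delta> n)\<^sup>2 * (real t)\<^sup>2) + 64 * real n / (\<delta> n)\<^sup>2"
          using elim t2 by (intro solvable_prob_ge G[rule_format]) auto
        then show "1 - \<epsilon> \<le> solvable_prob (\<G> n) t" using 1 2 by linarith
      qed
    qed
    then show ?thesis using K(1) unfolding f_def by (intro exI[of _ K]) auto
  qed
qed

theorem theorem3:
  fixes \<delta> :: "nat \<Rightarrow> real" and \<G> :: "nat \<Rightarrow> 'a pair_pre_digraph"
  assumes "\<forall>\<^sub>F n in sequentially. 0 \<le> \<delta> n"
    and "(\<lambda>n. sqrt (real n)) \<in> o(\<delta>)"
    and "\<And>n. n \<ge> 1 \<Longrightarrow> \<delta> n \<le> real n - 1"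
    and "\<And>n. n \<ge> 1 \<Longrightarrow> \<G> n \<in> connected_graphs_min_degree n (\<delta> n)"
  shows "pebbling_thresholds \<G> \<subseteq> O(\<lambda>n. real n powr (3 / 2) / \<delta> n) \<and>
    (\<delta> \<in> \<Omega>(\<lambda>n. real n) \<longrightarrow>
       pebbling_thresholds \<G> =
         {\<tau> \<in> \<Theta>(\<lambda>n. real n powr (1 / 2)). \<forall>\<^sub>F n in sequentially. 0 \<le> \<tau> n})"
proof (intro conjI impI)
  define f where "f = (\<lambda>n. real n powr (3 / 2) / \<delta> n)"
  have "\<forall>n\<ge>1. \<delta> n \<le> real n - 1" "\<forall>n\<ge>1. \<G> n \<in> connected_graphs_min_degree n (\<delta> n)"
    using assms(3,4) by blast+
  note ge = eventually_solvable_prob_ge[OF assms(1,2) this]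
  have pos: "\<forall>\<^sub>F n in sequentially. 0 < \<delta> n \<and> sqrt (real n) \<le> f n"
    unfolding f_def by (rule ge(1))
  have solvable: "\<exists>K>0. \<forall>\<^sub>F n in sequentially. \<forall>t. K * f n \<le> real t \<longrightarrow> 1 - \<epsilon> \<le> solvable_prob (\<G> n) t"
    if "0 < \<epsilon>" for \<epsilon>
    unfolding f_def by (rule ge(2)[OF that])
  have f1: "\<forall>\<^sub>F n in sequentially. 1 \<le> f n"
    using pos eventually_ge_at_top[of 1]
  proof eventually_elim
    case (elim n)
    then have "1 \<le> sqrt (real n)" by simp
    then show ?case using elim unfolding f_def by linarith
  qed
  show upper: "pebbling_thresholds \<G> \<subseteq> O(\<lambda>n. real n powr (3 / 2) / \<delta> n)"
  proof
    fix \<tau> assume \<tau>: "\<tau> \<in> pebbling_thresholds \<G>"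
    obtain K where "K > 0" "\<forall>\<^sub>F n in sequentially. \<forall>t. K * f n \<le> real t \<longrightarrow> 1 - 1 / 2 \<le> solvable_prob (\<G> n) t"
      using solvable[of "1 / 2"] by auto
    then show "\<tau> \<in> O(\<lambda>n. real n powr (3 / 2) / \<delta> n)"
      using threshold_le_of_solvable[OF \<tau> f1, of K] by (simp add: f_def)
  qed
  assume \<delta>: "\<delta> \<in> \<Omega>(\<lambda>n. real n)"
  define s where "s = (\<lambda>n. real n powr (1 / 2))"
  have s: "s n = sqrt (real n)" for n by (simp add: s_def powr_half_sqrt)
  have unsolvable: "\<forall>\<^sub>F n in sequentially. \<forall>t. solvable_prob (\<G> n) t \<le> (real t / s n)\<^sup>2"
    using eventually_ge_at_top[of 2]
  proof eventually_elim
    case (elim n)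
    then have "pair_graph (\<G> n)" "card (pverts (\<G> n)) = n"
      using assms(4)[of n] by (auto simp: connected_graphs_min_degree_def)
    moreover from this have "finite (pverts (\<G> n))"
      by (simp add: pair_fin_digraph.pair_finite_verts pair_graph.axioms pair_digraph.axioms)
    ultimately show ?case
      using solvable_prob_le[of "\<G> n" n] elim by (simp add: s power_divide)
  qed
  \<comment> \<open>Linear minimum degree brings the upper bound n^(3/2) / \<delta> down to the
    order of the square root of n, where it meets the general lower bound.\<close>
  have fs: "f \<in> O(s)"
  proof -
    from \<delta> obtain c where c: "c > 0" "\<forall>\<^sub>F n in sequentially. c * \<bar>real n\<bar> \<le> \<bar>\<delta> n\<bar>"
      by (auto elim!: landau_omega.bigE)
    from c(2) pos eventually_ge_at_top[of 1]
    have "\<forall>\<^sub>F n in sequentially. norm (f n) \<le> 1 / c * norm (s n)"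
    proof eventually_elim
      case (elim n)
      have "real n powr (3 / 2) = real n powr 1 * s n"
        unfolding s_def by (subst powr_add[symmetric]) simp
      also have "\<dots> \<le> (\<delta> n / c) * s n"
        using elim c(1) by (intro mult_right_mono) (auto simp: field_simps s)
      finally show ?case using elim c(1) by (simp add: f_def s field_simps)
    qed
    then show ?thesis by (rule bigoI)
  qed
  show "pebbling_thresholds \<G> = {\<tau> \<in> \<Theta>(\<lambda>n. real n powr (1 / 2)). \<forall>\<^sub>F n in sequentially. 0 \<le> \<tau> n}"
    unfolding s_def[symmetric]
  proof (intro equalityI subsetI)
    fix \<tau> assume \<tau>: "\<tau> \<in> pebbling_thresholds \<G>"
    have "\<tau> \<in> O(s)"
      using upper \<tau> fs landau_o.big_trans unfolding f_def by blast
    \<comment> \<open>With K = 1/2 the solvability probability is at most 1/4.\<close>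
    moreover have "s \<in> O(\<tau>)"
    proof (rule threshold_ge_of_unsolvable[OF \<tau>])
      show "\<forall>\<^sub>F n in sequentially. 1 \<le> 1 / 2 * s n"
        using eventually_ge_at_top[of 4]
      proof eventually_elim
        case (elim n)
        then show ?case using real_le_rsqrt[of 2 "real n"] by (simp add: s)
      qed
      show "\<forall>\<^sub>F n in sequentially. \<forall>t. real t \<le> 1 / 2 * s n \<longrightarrow> solvable_prob (\<G> n) t \<le> 1 / 2"
        using unsolvable eventually_ge_at_top[of 1]
      proof eventually_elim
        case (elim n)
        show ?case
        proof (intro allI impI)
          fix t assume t: "real t \<le> 1 / 2 * s n"
          have "s n > 0" using elim by (simp add: s)
          have "solvable_prob (\<G> n) t \<le> (real t / s n)\<^sup>2" using elim by blast
          also have "\<dots> \<le> (1 / 2)\<^sup>2"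
            using t \<open>s n > 0\<close> by (intro power_mono) (auto simp: field_simps)
          also have "\<dots> \<le> 1 / 2" by (simp add: power2_eq_square)
          finally show "solvable_prob (\<G> n) t \<le> 1 / 2" .
        qed
      qed
    qed simp
    ultimately show "\<tau> \<in> {\<tau> \<in> \<Theta>(s). \<forall>\<^sub>F n in sequentially. 0 \<le> \<tau> n}"
      using \<tau> by (auto simp: pebbling_thresholds_def bigomega_iff_bigo intro: bigthetaI)
  next
    \<comment> \<open>Conversely, every eventually nonnegative function of order \<open>s\<close> is
      a threshold, which makes the two sets equal.\<close>
    fix \<tau> assume "\<tau> \<in> {\<tau> \<in> \<Theta>(s). \<forall>\<^sub>F n in sequentially. 0 \<le> \<tau> n}"
    then have \<tau>: "\<tau> \<in> O(s)" "s \<in> O(\<tau>)" "\<forall>\<^sub>F n in sequentially. 0 \<le> \<tau> n"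
      by (auto simp flip: bigomega_iff_bigo)
    have "(\<lambda>n. solvable_prob (\<G> n) (t n)) \<longlonglongrightarrow> 1" if t: "\<tau> \<in> o(\<lambda>n. real (t n))" for t
    proof (rule order_tendstoI)
      fix a :: real assume "a < 1"
      define \<epsilon> where "\<epsilon> = (1 - a) / 2"
      have \<epsilon>: "\<epsilon> > 0" "a < 1 - \<epsilon>" using \<open>a < 1\<close> by (auto simp: \<epsilon>_def field_simps)
      obtain K where K: "K > 0" "\<forall>\<^sub>F n in sequentially. \<forall>t. K * f n \<le> real t \<longrightarrow> 1 - \<epsilon> \<le> solvable_prob (\<G> n) t"
        using solvable[OF \<epsilon>(1)] by auto
      \<comment> \<open>The chain is f = O(s), s = O(\<tau>), \<tau> = o(t); hence \<open>t\<close>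
        eventually exceeds \<open>K * f\<close> for every constant \<open>K\<close>.\<close>
      have "f \<in> o(\<lambda>n. real (t n))"
        using fs \<tau>(2) t by (blast intro: landau_o.big_trans landau_o.big_small_trans)
      then have "\<forall>\<^sub>F n in sequentially. norm (f n) \<le> 1 / K * norm (real (t n))"
        using K(1) by (intro landau_o.smallD) auto
      then show "\<forall>\<^sub>F n in sequentially. a < solvable_prob (\<G> n) (t n)"
        using K(2)
      proof eventually_elim
        case (elim n)
        have "K * f n \<le> K * norm (f n)" using K(1) by (intro mult_left_mono) auto
        also have "\<dots> \<le> real (t n)" using elim(1) K(1) by (simp add: field_simps)
        finally have "1 - \<epsilon> \<le> solvable_prob (\<G> n) (t n)" using elim(2) by blast
        then show ?case using \<epsilon>(2) by linarith
      qed
    next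
      fix a :: real assume "1 < a"
      then show "\<forall>\<^sub>F n in sequentially. solvable_prob (\<G> n) (t n) < a"
        using solvable_prob_le_1 le_less_trans by (intro always_eventually) blast
    qed
    moreover have "(\<lambda>n. solvable_prob (\<G> n) (t n)) \<longlonglongrightarrow> 0" if t: "(\<lambda>n. real (t n)) \<in> o(\<tau>)" for t
    proof (rule tendsto_sandwich[where f = "\<lambda>_. 0" and h = "\<lambda>n. (real (t n) / s n)\<^sup>2"])
      have "(\<lambda>n. real (t n)) \<in> o(s)" using t \<tau>(1) by (rule landau_o.small_big_trans)
      then have "(\<lambda>n. real (t n) / s n) \<longlonglongrightarrow> 0" by (rule smalloD_tendsto)
      then show "(\<lambda>n. (real (t n) / s n)\<^sup>2) \<longlonglongrightarrow> 0"
        using tendsto_power[of _ 0 sequentially 2] by fastforce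
      show "\<forall>\<^sub>F n in sequentially. solvable_prob (\<G> n) (t n) \<le> (real (t n) / s n)\<^sup>2"
        using unsolvable by eventually_elim auto
    qed (simp_all add: solvable_prob_nonneg)
    ultimately show "\<tau> \<in> pebbling_thresholds \<G>"
      using \<tau>(3) by (auto simp: pebbling_thresholds_def)
  qed
qed

end
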